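(* Let $D$ be a positive integer (so $D<\infty$) and let $\mathcal{R}:\mathbb{R}^D\to\mathbb{R}^D$ be a permutation (coordinate) randomization operator, i.e. $\mathcal{R}(x_1,\dots,x_D)=(\hat x_1,\dots,\hat x_D)$ where $(\hat x_1,\dots,\hat x_D)$ is a rearrangement of the coordinates $(x_1,\dots,x_D)$ by a permutation of $\{1,\dots,D\}$. Then $\|\mathcal{R}\|=1$.
   Context: $\|\mathcal{R}\|$ denotes the operator norm $\sup_{x\neq 0}\|\mathcal{R}x\|/\|x\|$ with respect to the Euclidean norm on $\mathbb{R}^D$. *)

theory Defs
  imports "HOL-Analysis.Analysis" "HOL-Combinatorics.Permutations"
begin

(* The coordinates are indexed by the finite type 'n, so D = CARD('n), which is positive.
   The permutation is a single one, independent of the argument x. *)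
definition permutation_randomization :: "(real ^ 'n \<Rightarrow> real ^ 'n) \<Rightarrow> bool" where
  "permutation_randomization R \<longleftrightarrow>
     (\<exists>\<pi>. \<pi> permutes (UNIV :: 'n set) \<and> (\<forall>x. R x = (\<chi> i. x $ \<pi> i)))"

end

theory Submission
  imports Defs
begin

text \<open>Permuting coordinates only reorders the sum of squares, so \<open>R\<close> is
  norm-preserving (\<open>norm_permutation_randomization\<close>) and has the operator norm of the
  identity.\<close>

lemma norm_permutation_randomization:
  assumes "permutation_randomization R"
  shows "norm (R x) = norm x"
proof -
  obtain \<pi> where \<pi>: "\<pi> permutes UNIV" and R: "\<And>x. R x = (\<chi> i. x $ \<pi> i)"
    using assms unfolding permutation_randomization_def by blast
  have "(\<Sum>i\<in>UNIV. (x $ \<pi> i)\<^sup>2) = (\<Sum>i\<in>UNIV. (x $ i)\<^sup>2)"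
    using sum.permute[OF \<pi>, of "\<lambda>i. (x $ i)\<^sup>2"] by (simp add: o_def)
  then show ?thesis
    by (simp add: R norm_vec_def L2_set_def)
qed

theorem lemma4p3:
  fixes R :: "real ^ 'n \<Rightarrow> real ^ 'n"
  assumes "permutation_randomization R"
  shows "onorm R = 1"
proof -
  \<comment> \<open>\<open>onorm\<close> is the supremum of \<open>norm (R x) / norm x\<close>, so
    it sees \<open>R\<close> only through \<open>norm (R x)\<close>.\<close>
  have "onorm R = onorm (\<lambda>x :: real ^ 'n. x)"
    using assms by (simp add: onorm_def norm_permutation_randomization)
  \<comment> \<open>The value is 1 because the space contains a nonzero vector: \<open>'n\<close> is
    nonempty.\<close>
  then show ?thesis
    by (simp add: onorm_id)
qed

end
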